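(* Let $G$ be a connected graph of order $n$, minimum degree $\delta$ and maximum degree $\Delta$. Then there exists a spanning tree $T$ of $G$ with \[ \rho(T) \leq \frac{3(n^2-\Delta^2)}{2(n-1)(\delta+1)} + 7. \]
   Context: For a connected graph $H$ of order $n \ge 2$ and a vertex $v$, the average distance of $v$ is $\overline{\sigma}(v,H) = \frac{1}{n-1}\sum_{u \in V(H)} d_H(v,u)$, where $d_H$ is the shortest-path distance in $H$. The remoteness $\rho(H)$ is the maximum of $\overline{\sigma}(v,H)$ over all vertices $v$ of $H$. *)

theory Defs
  imports Complex_Main "Graph_Theory.Graph_Theory"
begin

text \<open>
  Finite simple graphs are modelled by the locale \<^locale>\<open>graph\<close>: finite symmetric digraphs
  without loops and parallel arcs, in which an edge $uv$ is the pair of arcs from $u$ to $v$ and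
  from $v$ to $u$. The degree of a vertex is therefore its out-degree.
\<close>

definition min_degree :: "('a, 'b) pre_digraph \<Rightarrow> nat" where
  "min_degree G = Min (out_degree G ` verts G)"

definition max_degree :: "('a, 'b) pre_digraph \<Rightarrow> nat" where
  "max_degree G = Max (out_degree G ` verts G)"

definition graph_distance :: "('a, 'b) pre_digraph \<Rightarrow> 'a \<Rightarrow> 'a \<Rightarrow> nat" where
  "graph_distance G u v = (LEAST k. \<exists>p. pre_digraph.awalk G u p v \<and> length p = k)"

definition average_distance :: "('a, 'b) pre_digraph \<Rightarrow> 'a \<Rightarrow> real" where
  "average_distance H v =
     1 / (real (card (verts H)) - 1) * (\<Sum>u\<in>verts H. real (graph_distance H v u))"

definition remoteness :: "('a, 'b) pre_digraph \<Rightarrow> real" where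
  "remoteness H = Max (average_distance H ` verts H)"

text \<open>
  The library's \<^const>\<open>forest\<close> excludes all directed cycles. It is unsuitable for undirected
  trees: in a symmetric digraph every edge gives a directed cycle of length 2, while an acyclic
  orientation of an undirected cycle is a \<^const>\<open>forest\<close>. In a simple symmetric digraph the
  cycles of the undirected graph are exactly the directed cycles of length at least 3.
\<close>

definition undirected_tree :: "('a, 'b) pre_digraph \<Rightarrow> bool" where
  "undirected_tree T \<longleftrightarrow>
     Digraph.graph T \<and> Digraph_Component.connected T \<and>
     \<not> (\<exists>p. pre_digraph.cycle T p \<and> 3 \<le> length p)"

definition undirected_spanning_tree ::
    "('a, 'b) pre_digraph \<Rightarrow> ('a, 'b) pre_digraph \<Rightarrow> bool" where
  "undirected_spanning_tree T G \<longleftrightarrow> undirected_tree T \<and> spanning T G"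

text \<open>The distance is the library's shortest-path cost for unit weights.\<close>

lemma (in wf_digraph) graph_distance_eq_\<mu>:
  assumes "u \<rightarrow>\<^sup>* v"
  shows "\<mu> (\<lambda>_. 1) u v = ereal (real (graph_distance G u v))"
proof -
  have cost: "awalk_cost (\<lambda>_. 1) p = real (length p)" for p
    by (simp add: awalk_cost_def sum_list_triv)
  let ?P = "\<lambda>k. \<exists>p. awalk u p v \<and> length p = k"
  obtain p0 where "awalk u p0 v"
    using assms by (auto simp: reachable_awalk)
  then have "?P (length p0)" by blast
  then have "?P (graph_distance G u v)"
    unfolding graph_distance_def by (rule LeastI)
  then obtain p where p: "awalk u p v" "length p = graph_distance G u v" by blast
  have le: "graph_distance G u v \<le> length q" if "awalk u q v" for q
    unfolding graph_distance_def using that by (blast intro: Least_le)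
  show ?thesis
  proof (rule antisym)
    show "\<mu> (\<lambda>_. 1) u v \<le> ereal (real (graph_distance G u v))"
      using min_cost_le_walk_cost[OF p(1), of "\<lambda>_. 1"] by (simp add: cost p(2))
    show "ereal (real (graph_distance G u v)) \<le> \<mu> (\<lambda>_. 1) u v"
      unfolding \<mu>_def by (rule INF_greatest) (simp add: cost le)
  qed
qed

end

theory Submission
  imports Defs
begin

text \<open>
  Starting from a vertex of maximum degree, greedily choose a set \<open>A\<close> of vertices with pairwise
  disjoint closed neighbourhoods, each new one at distance exactly 3 from an earlier one. The stars
  around \<open>A\<close> and the linking edges form a tree, and by maximality every remaining vertex can be
  attached to it as a leaf, at distance 2 from \<open>A\<close>. Moving each vertex to its centre in \<open>A\<close> costs
  at most 2, so that up to an additive 4 the distances from a vertex are 3 times the levels of a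
  weighted graph on \<open>A\<close> in which every level is nonempty, every weight is at least \<open>\<delta> + 1\<close>,
  one weight is at least \<open>\<Delta> + 1\<close>, and the total weight is \<open>n\<close>. This forces the level sum to be
  at most \<open>(n\<^sup>2 - \<Delta>\<^sup>2) / (2 (\<delta> + 1))\<close>.
\<close>

section \<open>Weighted level sums and distance levels\<close>

text \<open>Let \<open>n\<close> be the total weight and \<open>K\<close> the top level. Each of the
  \<open>i\<close> levels below \<open>i\<close> carries weight at least \<open>m\<close>, so weight
  at most \<open>n - i * m\<close> lies at level \<open>i\<close> or higher. Summing over
  \<open>i\<close> from 1 to \<open>K\<close> bounds the level sum by \<open>K * n\<close> minus
  \<open>m\<close> times a triangular number, and the heavy element \<open>v\<close> forces
  \<open>n - K * m\<close> to exceed \<open>D\<close>.\<close>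

lemma level_weight_bound:
  fixes c L :: "'a \<Rightarrow> nat"
  assumes fin: "finite A" and v: "v \<in> A" "D < c v" and m: "\<And>a. a \<in> A \<Longrightarrow> m \<le> c a"
    and levels: "\<And>a i. a \<in> A \<Longrightarrow> i \<le> L a \<Longrightarrow> \<exists>b\<in>A. L b = i"
  shows "2 * m * (\<Sum>a\<in>A. c a * L a) + D\<^sup>2 \<le> (\<Sum>a\<in>A. c a)\<^sup>2"
proof -
  define n where "n = (\<Sum>a\<in>A. c a)"
  define K where "K = Max (L ` A)"
  have L_le: "L a \<le> K" if "a \<in> A" for a
    using that fin by (simp add: K_def)
  have "K \<in> L ` A"
    unfolding K_def using fin v by (intro Max_in) auto
  then have "\<exists>b\<in>A. L b = i" if "i \<le> K" for i
    using that levels by auto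
  \<comment> \<open>One representative per level; representatives of different levels are distinct,
    so their weights add up inside \<open>A\<close>.\<close>
  then obtain g where g: "\<And>i. i \<le> K \<Longrightarrow> g i \<in> A \<and> L (g i) = i"
    by metis
  have inj: "inj_on g I" if "I \<subseteq> {..K}" for I
    by (rule inj_onI) (metis g atMost_iff subsetD that)
  have below: "i * m \<le> (\<Sum>a | a \<in> A \<and> L a < i. c a)" if "i \<le> K" for i
  proof -
    have "i * m \<le> (\<Sum>j<i. c (g j))"
      using sum_bounded_below[of "{..<i}" m "\<lambda>j. c (g j)"] g m that by auto
    also have "\<dots> = (\<Sum>a\<in>g ` {..<i}. c a)"
      using that by (subst sum.reindex) (auto intro!: inj)
    also have "\<dots> \<le> (\<Sum>a | a \<in> A \<and> L a < i. c a)"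
      using fin g that by (intro sum_mono2) auto
    finally show ?thesis .
  qed
  have above: "(\<Sum>a | a \<in> A \<and> i \<le> L a. c a) + i * m \<le> n" if "i \<le> K" for i
  proof -
    have "n = (\<Sum>a | a \<in> A \<and> i \<le> L a. c a) + (\<Sum>a | a \<in> A \<and> L a < i. c a)"
      unfolding n_def using fin
      by (subst sum.union_disjoint[symmetric]) (auto intro!: arg_cong[where f = "sum c"])
    with below[OF that] show ?thesis by simp
  qed
  \<comment> \<open>Layer counting: \<open>c a\<close> is counted once for each of the levels 1 to
    \<open>L a\<close>, and the two sums are then exchanged.\<close>
  have "(\<Sum>a\<in>A. c a * L a) = (\<Sum>a\<in>A. \<Sum>i\<in>{1..K}. if i \<le> L a then c a else 0)"
  proof (rule sum.cong)
    fix a assume "a \<in> A"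
    have "(\<Sum>i\<in>{1..K}. if i \<le> L a then c a else 0) = (\<Sum>i\<in>{1..K} \<inter> {i. i \<le> L a}. c a)"
      by (subst sum.inter_restrict) auto
    also have "{1..K} \<inter> {i. i \<le> L a} = {1..L a}"
      using L_le[OF \<open>a \<in> A\<close>] by auto
    finally show "c a * L a = (\<Sum>i\<in>{1..K}. if i \<le> L a then c a else 0)" by simp
  qed simp
  also have "\<dots> = (\<Sum>i\<in>{1..K}. \<Sum>a | a \<in> A \<and> i \<le> L a. c a)"
    using fin by (subst sum.swap) (simp add: sum.inter_filter)
  finally have "(\<Sum>a\<in>A. c a * L a) + (\<Sum>i\<in>{1..K}. i * m)
      = (\<Sum>i\<in>{1..K}. (\<Sum>a | a \<in> A \<and> i \<le> L a. c a) + i * m)"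
    by (simp add: sum.distrib)
  also have "\<dots> \<le> K * n"
    using sum_bounded_above[of "{1..K}" "\<lambda>i. (\<Sum>a | a \<in> A \<and> i \<le> L a. c a) + i * m" n] above
    by simp
  finally have le: "(\<Sum>a\<in>A. c a * L a) + (\<Sum>i\<in>{1..K}. i) * m \<le> K * n"
    by (simp add: sum_distrib_right)
  have gauss: "2 * (\<Sum>i\<in>{1..K}. i) = K * (K + 1)"
    using double_gauss_sum_from_Suc_0[of K, where 'a = nat] by simp
  have total: "K * m + D < n"
  proof -
    \<comment> \<open>The representative at the level of \<open>v\<close> is replaced by
      \<open>v\<close> itself: the other \<open>K\<close> of the \<open>K + 1\<close> levels
      contribute \<open>K * m\<close>, and \<open>v\<close> contributes more than
      \<open>D\<close>.\<close>
    define h where "h = g(L v := v)"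
    have h: "h i \<in> A \<and> L (h i) = i" if "i \<le> K" for i
      using that g v by (auto simp: h_def)
    have inj_h: "inj_on h {..K}"
      by (rule inj_onI) (metis h atMost_iff)
    have "K * m \<le> (\<Sum>i\<in>{..K} - {L v}. c (h i))"
      using sum_bounded_below[of "{..K} - {L v}" m "\<lambda>i. c (h i)"] h m L_le[OF v(1)] by simp
    then have "K * m + D < (\<Sum>i\<in>{..K} - {L v}. c (h i)) + c (h (L v))"
      using v(2) by (simp add: h_def)
    also have "\<dots> = (\<Sum>i\<in>{..K}. c (h i))"
      using L_le[OF v(1)] by (subst sum.remove[of "{..K}" "L v"]) auto
    also have "\<dots> = (\<Sum>a\<in>h ` {..K}. c a)"
      by (simp add: sum.reindex[OF inj_h])
    also have "\<dots> \<le> n"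
      unfolding n_def using fin h by (intro sum_mono2) auto
    finally show ?thesis .
  qed
  \<comment> \<open>With \<open>r = n - K m > D\<close> the bound \<open>2 K m n - (K m)\<^sup>2\<close> on \<open>2 m S\<close> equals \<open>n\<^sup>2 - r\<^sup>2\<close>.\<close>
  define S where "S = (\<Sum>a\<in>A. c a * L a)"
  obtain r where r: "n = K * m + r" "D \<le> r"
    using total by (metis add.commute add_lessD1 le_add_diff_inverse less_imp_le_nat nat_add_left_cancel_le)
  have "2 * m * S + m * m * (2 * (\<Sum>i\<in>{1..K}. i)) \<le> 2 * m * (K * n)"
    using mult_le_mono2[OF le, of "2 * m"] unfolding S_def by (simp add: algebra_simps)
  then have "2 * m * S + m * m * (K * (K + 1)) \<le> 2 * m * (K * n)"
    unfolding gauss .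
  \<comment> \<open>The product \<open>m * m * (K * (K + 1))\<close> is
    \<open>(K * m)\<^sup>2\<close> plus \<open>m * m * K\<close>; the latter term is given
    away.\<close>
  then have "2 * m * S + (K * m)\<^sup>2 \<le> 2 * (K * m) * n"
    by (simp add: algebra_simps power2_eq_square)
  then have "2 * m * S \<le> (K * m)\<^sup>2 + 2 * (K * m) * r"
    by (simp add: r(1) algebra_simps power2_eq_square)
  moreover have "D\<^sup>2 \<le> r\<^sup>2"
    using r(2) by (simp add: power_mono)
  moreover have "n\<^sup>2 = (K * m)\<^sup>2 + 2 * (K * m) * r + r\<^sup>2"
    by (simp add: r(1) power2_sum)
  ultimately show ?thesis
    unfolding S_def n_def by linarith
qed

text \<open>Cut a shortest walk from \<open>a0\<close> to \<open>a\<close> after \<open>i\<close>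
  steps. A shorter walk to the cut vertex would also shorten the walk to \<open>a\<close>, so its
  level is exactly \<open>i\<close>. This provides the nonempty levels that
  \<open>level_weight_bound\<close> assumes.\<close>

lemma relpow_distance_levels:
  assumes R: "R \<subseteq> A \<times> A" and a0: "a0 \<in> A" and a: "(a0, a) \<in> R\<^sup>*"
    and i: "i \<le> (LEAST k. (a0, a) \<in> R ^^ k)"
  shows "\<exists>b\<in>A. (a0, b) \<in> R\<^sup>* \<and> (LEAST k. (a0, b) \<in> R ^^ k) = i"
proof -
  define l where "l b = (LEAST k. (a0, b) \<in> R ^^ k)" for b
  have l: "(a0, b) \<in> R ^^ l b" if "(a0, b) \<in> R ^^ k" for b k
    unfolding l_def using that by (rule LeastI)
  have l_le: "l b \<le> k" if "(a0, b) \<in> R ^^ k" for b k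
    unfolding l_def using that by (rule Least_le)
  obtain k where "(a0, a) \<in> R ^^ k"
    using a by (auto simp: rtrancl_is_UN_relpow)
  then have "(a0, a) \<in> R ^^ (i + (l a - i))"
    using i l by (simp add: l_def)
  then obtain b where b: "(a0, b) \<in> R ^^ i" "(b, a) \<in> R ^^ (l a - i)"
    unfolding relpow_add by blast
  then have "(a0, a) \<in> R ^^ (l b + (l a - i))"
    unfolding relpow_add using l by blast
  then have "l a \<le> l b + (l a - i)" by (rule l_le)
  with i l_le[OF b(1)] have "l b = i" by (auto simp: l_def)
  moreover have reach: "(a0, b) \<in> R\<^sup>*"
    using b(1) by (rule relpow_imp_rtrancl)
  moreover have "b \<in> A"
    using reach a0 R by induction auto
  ultimately show ?thesis by (auto simp: l_def)
qed

section \<open>Trees grown leaf by leaf\<close>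

text \<open>A tree is its vertex set together with a symmetric edge relation. Growth by single
  leaves turns connectedness and the absence of cycles into inductions, and matches the way the
  spanning tree is built.\<close>

inductive leaf_tree :: "'a set \<Rightarrow> 'a rel \<Rightarrow> bool" where
  root: "leaf_tree {v} {}"
| leaf: "leaf_tree U F \<Longrightarrow> y \<in> U \<Longrightarrow> x \<notin> U \<Longrightarrow> leaf_tree (insert x U) (F \<union> {(x, y), (y, x)})"

lemma leaf_tree_subset: "leaf_tree U F \<Longrightarrow> F \<subseteq> U \<times> U"
  by (induction rule: leaf_tree.induct) auto

lemma leaf_tree_sym: "leaf_tree U F \<Longrightarrow> sym F"
  by (induction rule: leaf_tree.induct) (auto simp: sym_def)

lemma leaf_tree_connected:
  assumes "leaf_tree U F" "u \<in> U" "w \<in> U"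
  shows "(u, w) \<in> F\<^sup>*"
  using assms
proof (induction arbitrary: u w rule: leaf_tree.induct)
  case (leaf U F y x)
  let ?F = "F \<union> {(x, y), (y, x)}"
  have mono: "(s, t) \<in> ?F\<^sup>*" if "s \<in> U" "t \<in> U" for s t
    using leaf.IH[OF that] by (rule rtrancl_mono[THEN subsetD, rotated]) auto
  have xy: "(x, y) \<in> ?F" "(y, x) \<in> ?F" by auto
  show ?case
    using leaf.prems leaf.hyps(2) mono xy
    by (auto intro: converse_rtrancl_into_rtrancl rtrancl_into_rtrancl)
qed simp

text \<open>A cycle absent from the smaller tree must pass through the new leaf \<open>x\<close>.
  The only neighbour of \<open>x\<close> is \<open>y\<close>, so \<open>y\<close> would both precede
  and follow \<open>x\<close>, which distinctness forbids from length 3 on. Length 2 has to be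
  excluded because \<open>F\<close> contains both orientations of each edge.\<close>

lemma leaf_tree_acyclic:
  assumes "leaf_tree U F" "distinct vs" "3 \<le> length vs"
  shows "\<exists>i<length vs. (vs ! i, vs ! (Suc i mod length vs)) \<notin> F"
  using assms
proof (induction rule: leaf_tree.induct)
  case (leaf U F y x)
  let ?l = "length vs"
  let ?F = "F \<union> {(x, y), (y, x)}"
  show ?case
  proof (rule ccontr)
    assume "\<not> ?thesis"
    then have cyc: "(vs ! i, vs ! (Suc i mod ?l)) \<in> ?F" if "i < ?l" for i
      using that by blast
    obtain i where i: "i < ?l" "(vs ! i, vs ! (Suc i mod ?l)) \<notin> F"
      using leaf.IH leaf.prems by blast
    with cyc have "vs ! i = x \<or> vs ! (Suc i mod ?l) = x"
      by auto
    moreover have "Suc i mod ?l < ?l" using leaf.prems by (intro mod_less_divisor) auto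
    ultimately obtain j where j: "j < ?l" "vs ! j = x"
      using i(1) by blast
    \<comment> \<open>The cyclic predecessor of \<open>j\<close>; the case \<open>j = 0\<close>
      wraps around to the last index.\<close>
    define p where "p = (if j = 0 then ?l - 1 else j - 1)"
    have p: "p < ?l" "Suc p mod ?l = j"
      using j(1) by (auto simp: p_def)
    have s: "Suc j mod ?l < ?l" using leaf.prems by (intro mod_less_divisor) auto
    have notF: "(x, z) \<notin> F" "(z, x) \<notin> F" for z
      using leaf_tree_subset[OF leaf.hyps(1)] leaf.hyps(3) by auto
    have "x \<noteq> y" using leaf.hyps by auto
    with cyc[OF j(1)] j(2) notF have "vs ! (Suc j mod ?l) = y" by auto
    moreover from cyc[OF p(1)] p(2) j(2) notF \<open>x \<noteq> y\<close> have "vs ! p = y" by auto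
    ultimately have "Suc j mod ?l = p"
      using nth_eq_iff_index_eq[OF leaf.prems(1) s p(1)] by simp
    then show False
      using j(1) leaf.prems(2) by (cases "Suc j = ?l") (auto simp: p_def split: if_splits)
  qed
next
  case (root v)
  then show ?case by (intro exI[of _ 0]) auto
qed

text \<open>Every attachment point lies in the old tree, so the new leaves can be added in any
  order. With constant \<open>h\<close> this adds the leaves of a star; with a choice function it
  adds the vertices left outside all stars.\<close>

lemma leaf_tree_attach:
  assumes "finite Z" "leaf_tree U F" "Z \<inter> U = {}" "h ` Z \<subseteq> U"
  shows "leaf_tree (U \<union> Z) (F \<union> (\<Union>z\<in>Z. {(z, h z), (h z, z)}))"
  using assms
proof (induction Z rule: finite_induct)
  case (insert x Z)
  have "leaf_tree (insert x (U \<union> Z))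
      ((F \<union> (\<Union>z\<in>Z. {(z, h z), (h z, z)})) \<union> {(x, h x), (h x, x)})"
    using insert by (intro leaf_tree.leaf) auto
  moreover have "(F \<union> (\<Union>z\<in>Z. {(z, h z), (h z, z)})) \<union> {(x, h x), (h x, x)}
      = F \<union> (\<Union>z\<in>insert x Z. {(z, h z), (h z, z)})"
    by blast
  ultimately show ?case by simp
qed simp

section \<open>Packing disjoint stars\<close>

abbreviation closed_nbhd :: "'a rel \<Rightarrow> 'a \<Rightarrow> 'a set" where
  "closed_nbhd E a \<equiv> insert a (E `` {a})"

text \<open>
  The factor \<open>F O F O F\<close> records that the linked centres in \<open>A\<close> are joined by walks of length 3 in
  the tree \<open>F\<close>.
\<close>

definition star_packing :: "'a rel \<Rightarrow> 'a \<Rightarrow> 'a set \<Rightarrow> 'a rel \<Rightarrow> bool" where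
  "star_packing E v A F \<longleftrightarrow> v \<in> A \<and> F \<subseteq> E \<and> leaf_tree (\<Union>a\<in>A. closed_nbhd E a) F \<and>
     (\<forall>a\<in>A. \<forall>b\<in>A. a \<noteq> b \<longrightarrow> closed_nbhd E a \<inter> closed_nbhd E b = {}) \<and>
     (\<forall>a\<in>A. \<forall>z. (a, z) \<in> E \<longrightarrow> (a, z) \<in> F) \<and>
     (\<forall>a\<in>A. (v, a) \<in> ((F O F O F) \<inter> A \<times> A)\<^sup>*)"

lemma star_packing_singleton:
  assumes "finite E" "sym E" "irrefl E"
  shows "star_packing E v {v} (\<Union>z\<in>E `` {v}. {(z, v), (v, z)})"
proof -
  have "leaf_tree ({v} \<union> E `` {v}) ({} \<union> (\<Union>z\<in>E `` {v}. {(z, v), (v, z)}))"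
    using assms by (intro leaf_tree_attach leaf_tree.root) (auto simp: irrefl_def)
  then show ?thesis
    using assms(2) by (auto simp: star_packing_def sym_def)
qed

text \<open>The greedy step. The tree grows by hanging \<open>x\<close> on \<open>y\<close>, then
  \<open>a\<close> on \<open>x\<close>, then the remaining neighbours \<open>Z\<close> of
  \<open>a\<close> on \<open>a\<close>. If \<open>y\<close> lies in the star of \<open>b\<close>,
  the new centre is linked to \<open>b\<close> by the walk \<open>b\<close>, \<open>y\<close>,
  \<open>x\<close>, \<open>a\<close>.\<close>

lemma star_packing_insert:
  assumes fin: "finite E" and sym: "sym E" and irr: "irrefl E" and P: "star_packing E v A F"
    and disj: "closed_nbhd E a \<inter> (\<Union>b\<in>A. closed_nbhd E b) = {}"
    and x: "(a, x) \<in> E" and xy: "(x, y) \<in> E" and y: "y \<in> (\<Union>b\<in>A. closed_nbhd E b)"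
  shows "\<exists>F'. star_packing E v (insert a A) F'"
proof -
  define U where "U = (\<Union>b\<in>A. closed_nbhd E b)"
  define Z where "Z = E `` {a} - {x}"
  define F1 where "F1 = F \<union> {(x, y), (y, x)} \<union> {(a, x), (x, a)}"
  define F' where "F' = F1 \<union> (\<Union>z\<in>Z. {(z, a), (a, z)})"
  from P have v: "v \<in> A" and FE: "F \<subseteq> E" and tree: "leaf_tree U F"
    and D: "\<And>a b. a \<in> A \<Longrightarrow> b \<in> A \<Longrightarrow> a \<noteq> b \<Longrightarrow> closed_nbhd E a \<inter> closed_nbhd E b = {}"
    and star: "\<And>a z. a \<in> A \<Longrightarrow> (a, z) \<in> E \<Longrightarrow> (a, z) \<in> F"
    and conn: "\<And>a. a \<in> A \<Longrightarrow> (v, a) \<in> ((F O F O F) \<inter> A \<times> A)\<^sup>*"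
    unfolding star_packing_def U_def by blast+
  have yU: "y \<in> U" using y by (simp add: U_def)
  have xU: "x \<notin> U" and aU: "a \<notin> U" and ZU: "Z \<inter> U = {}"
    using disj x by (auto simp: U_def Z_def)
  have ax: "a \<noteq> x" and aZ: "a \<notin> Z" using irr x by (auto simp: irrefl_def Z_def)
  have "leaf_tree (insert a (insert x U)) F1"
    unfolding F1_def by (intro leaf_tree.leaf tree yU xU) (use ax aU in auto)
  then have "leaf_tree (insert a (insert x U) \<union> Z) F'"
    unfolding F'_def
    by (intro leaf_tree_attach[where h = "\<lambda>_. a"]) (use fin aZ ZU in \<open>auto simp: Z_def\<close>)
  moreover have "insert a (insert x U) \<union> Z = (\<Union>b\<in>insert a A. closed_nbhd E b)"
    using x by (auto simp: U_def Z_def)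
  ultimately have tree': "leaf_tree (\<Union>b\<in>insert a A. closed_nbhd E b) F'" by simp
  have symE: "(s, t) \<in> E \<Longrightarrow> (t, s) \<in> E" for s t using sym by (auto simp: sym_def)
  have F'E: "F' \<subseteq> E"
    using FE x xy symE by (auto simp: F'_def F1_def Z_def)
  have FF': "F \<subseteq> F'" by (auto simp: F'_def F1_def)
  obtain b where b: "b \<in> A" "y \<in> closed_nbhd E b"
    using y by auto
  \<comment> \<open>Here \<open>y = b\<close> is impossible: \<open>x\<close> would then be a
    neighbour of \<open>b\<close> and hence lie in \<open>U\<close>. So the link has length exactly
    3.\<close>
  have "(b, y) \<in> E"
    using b xU symE[OF xy] by (auto simp: U_def)
  then have "(b, y) \<in> F'" using star b FF' by blast
  then have "(b, a) \<in> F' O F' O F'"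
    by (auto simp: F'_def F1_def)
  moreover have "(v, c) \<in> ((F' O F' O F') \<inter> insert a A \<times> insert a A)\<^sup>*" if "c \<in> A" for c
    using conn[OF that] by (rule rtrancl_mono[THEN subsetD, rotated]) (use FF' in blast)
  ultimately have conn': "\<forall>c\<in>insert a A. (v, c) \<in> ((F' O F' O F') \<inter> insert a A \<times> insert a A)\<^sup>*"
    using b(1) by (auto intro: rtrancl_into_rtrancl)
  have "(a, z) \<in> F'" if "(a, z) \<in> E" for z
    using that by (auto simp: F'_def F1_def Z_def)
  then have star': "\<forall>c\<in>insert a A. \<forall>z. (c, z) \<in> E \<longrightarrow> (c, z) \<in> F'"
    using star FF' by blast
  have disj_a: "closed_nbhd E a \<inter> closed_nbhd E c = {}" if "c \<in> A" for c
    using disj that by blast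
  have D': "\<forall>c\<in>insert a A. \<forall>d\<in>insert a A. c \<noteq> d \<longrightarrow> closed_nbhd E c \<inter> closed_nbhd E d = {}"
  proof (intro ballI impI)
    fix c d assume "c \<in> insert a A" "d \<in> insert a A" "c \<noteq> d"
    then consider "c \<in> A" "d \<in> A" | "c = a" "d \<in> A" | "d = a" "c \<in> A" by blast
    then show "closed_nbhd E c \<inter> closed_nbhd E d = {}"
      using D[OF _ _ \<open>c \<noteq> d\<close>] disj_a by cases blast+
  qed
  have "star_packing E v (insert a A) F'"
    unfolding star_packing_def using v F'E tree' D' star' conn' by (intro conjI) simp_all
  then show ?thesis ..
qed

text \<open>Let \<open>W\<close> consist of \<open>U\<close> and all vertices adjacent to
  \<open>U\<close>. If an edge led from \<open>x\<close> in \<open>W\<close> to \<open>a\<close>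
  outside \<open>W\<close>, the closed neighbourhood of \<open>a\<close> would miss
  \<open>U\<close>, while \<open>x\<close> would lie outside \<open>U\<close> with a neighbour in
  \<open>U\<close>; so \<open>a\<close> could be added as a centre. Thus a maximal packing has
  \<open>W\<close> closed under edges, and connectedness gives all of \<open>V\<close>.\<close>

lemma maximal_star_packing:
  assumes fin: "finite V" and EV: "E \<subseteq> V \<times> V" and sym: "sym E" and irr: "irrefl E"
    and v: "v \<in> V" and conn: "\<And>u w. u \<in> V \<Longrightarrow> w \<in> V \<Longrightarrow> (u, w) \<in> E\<^sup>*"
  shows "\<exists>A F. star_packing E v A F \<and> A \<subseteq> V \<and>
    (\<forall>u\<in>V. \<exists>y\<in>(\<Union>a\<in>A. closed_nbhd E a). u = y \<or> (u, y) \<in> E)"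
proof -
  have finE: "finite E" using fin EV by (meson finite_SigmaI finite_subset)
  let ?\<A> = "{A. A \<subseteq> V \<and> (\<exists>F. star_packing E v A F)}"
  have "finite ?\<A>" using fin by (auto intro: finite_subset[of _ "Pow V"])
  moreover have "{v} \<in> ?\<A>"
    using v star_packing_singleton[OF finE sym irr] by blast
  ultimately obtain A where A: "A \<in> ?\<A>" and max: "\<And>B. B \<in> ?\<A> \<Longrightarrow> A \<subseteq> B \<Longrightarrow> A = B"
    using finite_has_maximal[of ?\<A>] by (metis (no_types, lifting) empty_iff)
  then obtain F where F: "star_packing E v A F" and AV: "A \<subseteq> V" by blast
  define U where "U = (\<Union>a\<in>A. closed_nbhd E a)"
  define W where "W = U \<union> {u. \<exists>y\<in>U. (u, y) \<in> E}"
  have symE: "(s, t) \<in> E \<Longrightarrow> (t, s) \<in> E" for s t using sym by (auto simp: sym_def)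
  have closed: "a \<in> W" if xW: "x \<in> W" and xa: "(x, a) \<in> E" for x a
  proof (rule ccontr)
    assume a: "a \<notin> W"
    have "x \<notin> U" using a xa symE by (auto simp: W_def)
    then obtain y where y: "y \<in> U" "(x, y) \<in> E"
      using xW by (auto simp: W_def)
    have disj: "closed_nbhd E a \<inter> (\<Union>b\<in>A. closed_nbhd E b) = {}"
      using a unfolding W_def U_def[symmetric] by auto
    then obtain F' where "star_packing E v (insert a A) F'"
      using star_packing_insert[OF finE sym irr F disj symE[OF xa] y(2)] y(1)
      by (auto simp: U_def)
    moreover have "a \<in> V" using xa EV by auto
    ultimately have "insert a A \<in> ?\<A>" using AV by blast
    then have "a \<in> A" using max by blast
    then show False using a by (auto simp: W_def U_def)
  qed
  have vW: "v \<in> W" using F by (auto simp: star_packing_def W_def U_def)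
  have "u \<in> W" if "u \<in> V" for u
    using conn[OF v that] vW by induction (auto intro: closed)
  then have "\<forall>u\<in>V. \<exists>y\<in>U. u = y \<or> (u, y) \<in> E"
    by (auto simp: W_def)
  then show ?thesis
    using F AV unfolding U_def by blast
qed

section \<open>The spanning tree and its distances\<close>

lemma relcomp3_relpow: "(a, b) \<in> (F O F O F) ^^ k \<Longrightarrow> (a, b) \<in> F ^^ (3 * k)"
proof (induction k arbitrary: b)
  case (Suc k)
  then obtain c where c: "(a, c) \<in> F ^^ (3 * k)" and "(c, b) \<in> F O F O F" by auto
  then have "(c, b) \<in> F ^^ 3" by (auto simp: numeral_3_eq_3)
  with c have "(a, b) \<in> F ^^ (3 * k + 3)" unfolding relpow_add by blast
  then show ?case by (simp add: algebra_simps)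
qed simp

lemma relpow_mono_rel: "R \<subseteq> S \<Longrightarrow> R ^^ k \<subseteq> S ^^ k" for R S :: "'a rel"
  by (induction k) (simp_all add: relcomp_mono)

lemma relpow_sym: "sym F \<Longrightarrow> (a, b) \<in> F ^^ k \<Longrightarrow> (b, a) \<in> F ^^ k"
  by (induction k arbitrary: b) (auto simp del: relpow.simps(2) elim!: relpow_Suc_E dest: symD intro: relpow_Suc_I2)

text \<open>For fixed \<open>w\<close>, \<open>d u\<close> is the level of the centre of
  \<open>u\<close>, measured from the centre of \<open>w\<close> in the graph of linked centres.
  Each link costs 3 tree edges, and the passages from \<open>w\<close> to its centre and from the
  centre of \<open>u\<close> to \<open>u\<close> cost at most 2 each, which gives the 4. One tree
  \<open>F\<close> serves all \<open>w\<close>; only \<open>d\<close> varies.\<close>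

lemma spanning_leaf_tree:
  assumes fin: "finite V" and EV: "E \<subseteq> V \<times> V" and sym: "sym E" and irr: "irrefl E"
    and v: "v \<in> V" and conn: "\<And>u w. u \<in> V \<Longrightarrow> w \<in> V \<Longrightarrow> (u, w) \<in> E\<^sup>*"
    and deg: "\<And>u. u \<in> V \<Longrightarrow> \<delta> \<le> card (E `` {u})" and degv: "card (E `` {v}) = D"
  shows "\<exists>F. leaf_tree V F \<and> F \<subseteq> E \<and>
    (\<forall>w\<in>V. \<exists>d. (\<forall>u\<in>V. \<exists>k\<le>4 + 3 * d u. (w, u) \<in> F ^^ k) \<and>
      2 * (\<delta> + 1) * (\<Sum>u\<in>V. d u) + D\<^sup>2 \<le> (card V)\<^sup>2)"
proof -
  obtain A F0 where P: "star_packing E v A F0" and AV: "A \<subseteq> V"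
    and cover: "\<forall>u\<in>V. \<exists>y\<in>(\<Union>a\<in>A. closed_nbhd E a). u = y \<or> (u, y) \<in> E"
    using maximal_star_packing[OF fin EV sym irr v conn] by blast
  define U where "U = (\<Union>a\<in>A. closed_nbhd E a)"
  from P have vA: "v \<in> A" and F0E: "F0 \<subseteq> E" and tree0: "leaf_tree U F0"
    and D: "\<And>a b. a \<in> A \<Longrightarrow> b \<in> A \<Longrightarrow> a \<noteq> b \<Longrightarrow> closed_nbhd E a \<inter> closed_nbhd E b = {}"
    and star: "\<And>a z. a \<in> A \<Longrightarrow> (a, z) \<in> E \<Longrightarrow> (a, z) \<in> F0"
    and conn0: "\<And>a. a \<in> A \<Longrightarrow> (v, a) \<in> ((F0 O F0 O F0) \<inter> A \<times> A)\<^sup>*"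
    unfolding star_packing_def U_def by blast+
  have UV: "U \<subseteq> V" using AV EV by (auto simp: U_def)
  have "\<exists>y\<in>U. (u, y) \<in> E" if "u \<in> V - U" for u
    using cover that unfolding U_def[symmetric] by blast
  then obtain h where h: "\<And>u. u \<in> V - U \<Longrightarrow> h u \<in> U \<and> (u, h u) \<in> E" by metis
  define F where "F = F0 \<union> (\<Union>z\<in>V - U. {(z, h z), (h z, z)})"
  have "leaf_tree (U \<union> (V - U)) F"
    unfolding F_def using fin h by (intro leaf_tree_attach tree0) auto
  then have tree: "leaf_tree V F" using UV by (simp add: Un_absorb1)
  have symF: "sym F" using tree by (rule leaf_tree_sym)
  have FE: "F \<subseteq> E" using F0E h sym by (auto simp: F_def dest: symD)
  have "\<exists>a\<in>A. u \<in> closed_nbhd E a" if "u \<in> U" for u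
    using that by (auto simp: U_def)
  then obtain f0 where f0: "\<And>u. u \<in> U \<Longrightarrow> f0 u \<in> A \<and> u \<in> closed_nbhd E (f0 u)" by metis
  \<comment> \<open>The centre of \<open>u\<close>; a vertex outside the stars inherits the centre
    of the vertex it hangs from.\<close>
  define f where "f u = f0 (if u \<in> U then u else h u)" for u
  have fA: "f u \<in> A" if "u \<in> V" for u using that f0 h by (auto simp: f_def)
  have f_nbhd: "f u = a" if "a \<in> A" "u \<in> closed_nbhd E a" for u a
  proof -
    have "u \<in> U" using that by (auto simp: U_def)
    then have "f0 u \<in> A" "u \<in> closed_nbhd E (f0 u)" "f u = f0 u"
      using f0 by (auto simp: f_def)
    then show ?thesis using that D by (metis IntI empty_iff)
  qed
  have near0: "\<exists>k\<le>1. (f0 u, u) \<in> F ^^ k" if "u \<in> U" for u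
  proof (cases "f0 u = u")
    case True
    then show ?thesis by (intro exI[of _ 0]) simp
  next
    case False
    then have "(f0 u, u) \<in> F" using f0[OF that] star by (auto simp: F_def)
    then show ?thesis by (intro exI[of _ 1]) simp
  qed
  have near: "\<exists>k\<le>2. (f u, u) \<in> F ^^ k" if uV: "u \<in> V" for u
  proof (cases "u \<in> U")
    case True
    then obtain k where "k \<le> 1" "(f u, u) \<in> F ^^ k"
      using near0[of u] by (auto simp: f_def)
    then show ?thesis by (intro exI[of _ k]) simp
  next
    case False
    then obtain k where k: "k \<le> 1" "(f u, h u) \<in> F ^^ k"
      using near0[of "h u"] h[of u] uV by (auto simp: f_def)
    have "(h u, u) \<in> F" using False uV by (auto simp: F_def)
    with k show ?thesis by (intro exI[of _ "Suc k"]) auto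
  qed
  define c where "c a = card {u \<in> V. f u = a}" for a
  have finA: "finite A" using fin AV by (rule finite_subset[rotated])
  \<comment> \<open>The fibre of \<open>f\<close> over \<open>a\<close> contains the whole closed
    neighbourhood of \<open>a\<close>, which has one element more than the degree; hence the strict
    inequality.\<close>
  have c_ge: "card (E `` {a}) < c a" if "a \<in> A" for a
  proof -
    have "finite (E `` {a})" using fin EV by (auto intro: finite_subset)
    moreover have "a \<notin> E `` {a}" using irr by (auto simp: irrefl_def)
    ultimately have "Suc (card (E `` {a})) = card (closed_nbhd E a)" by simp
    also have "\<dots> \<le> c a"
      unfolding c_def using that fin AV EV f_nbhd by (intro card_mono) auto
    finally show ?thesis by simp
  qed
  have c_sum: "(\<Sum>a\<in>A. c a * L a) = (\<Sum>u\<in>V. L (f u))" for L :: "'a \<Rightarrow> nat"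
  proof -
    have "(\<Sum>u\<in>V. L (f u)) = (\<Sum>a\<in>A. \<Sum>u | u \<in> V \<and> f u = a. L (f u))"
      using fin finA fA by (intro sum.group[symmetric]) auto
    also have "\<dots> = (\<Sum>a\<in>A. c a * L a)"
      by (intro sum.cong) (auto simp: c_def)
    finally show ?thesis by simp
  qed
  \<comment> \<open>The packing only gives reachability of centres from \<open>v\<close>. Symmetry
    of \<open>R\<close> extends it to any two centres, since levels will be measured from
    \<open>f w\<close>.\<close>
  define R where "R = (F O F O F) \<inter> A \<times> A"
  have RA: "R \<subseteq> A \<times> A" by (auto simp: R_def)
  have "sym R" using symF unfolding R_def sym_def by blast
  have R_v: "(v, a) \<in> R\<^sup>*" if "a \<in> A" for a
    using conn0[OF that] by (rule rtrancl_mono[THEN subsetD, rotated]) (auto simp: R_def F_def)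
  have R_conn: "(a, b) \<in> R\<^sup>*" if "a \<in> A" "b \<in> A" for a b
    using R_v[OF that(1)] R_v[OF that(2)] sym_rtrancl[OF \<open>sym R\<close>] by (meson rtrancl_trans symD)
  have "\<exists>d. (\<forall>u\<in>V. \<exists>k\<le>4 + 3 * d u. (w, u) \<in> F ^^ k) \<and>
      2 * (\<delta> + 1) * (\<Sum>u\<in>V. d u) + D\<^sup>2 \<le> (card V)\<^sup>2" if w: "w \<in> V" for w
  proof -
    define L where "L a = (LEAST k. (f w, a) \<in> R ^^ k)" for a
    have "2 * (\<delta> + 1) * (\<Sum>a\<in>A. c a * L a) + D\<^sup>2 \<le> (\<Sum>a\<in>A. c a)\<^sup>2"
    proof (rule level_weight_bound[OF finA vA])
      show "D < c v" using c_ge[OF vA] degv by simp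
      show "\<delta> + 1 \<le> c a" if "a \<in> A" for a
        using c_ge[OF that] deg[of a] that AV by auto
      show "\<exists>b\<in>A. L b = i" if "a \<in> A" "i \<le> L a" for a i
        using relpow_distance_levels[OF RA fA[OF w] R_conn[OF fA[OF w] that(1)], of i] that(2)
        unfolding L_def by blast
    qed
    moreover have "(\<Sum>a\<in>A. c a) = card V"
      using c_sum[of "\<lambda>_. 1"] by simp
    moreover have "\<exists>k\<le>4 + 3 * L (f u). (w, u) \<in> F ^^ k" if u: "u \<in> V" for u
    proof -
      obtain i where i: "i \<le> 2" "(f w, w) \<in> F ^^ i" using near[OF w] by blast
      obtain j where j: "j \<le> 2" "(f u, u) \<in> F ^^ j" using near[OF u] by blast
      obtain k where "(f w, f u) \<in> R ^^ k"
        using R_conn[OF fA[OF w] fA[OF u]] by (auto simp: rtrancl_is_UN_relpow)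
      then have "(f w, f u) \<in> R ^^ L (f u)" unfolding L_def by (rule LeastI)
      then have "(f w, f u) \<in> (F O F O F) ^^ L (f u)"
        by (rule subsetD[OF relpow_mono_rel, rotated]) (auto simp: R_def)
      then have "(f w, f u) \<in> F ^^ (3 * L (f u))" by (rule relcomp3_relpow)
      with relpow_sym[OF symF i(2)] j(2) have "(w, u) \<in> F ^^ (i + 3 * L (f u) + j)"
        unfolding relpow_add by blast
      then show ?thesis using i(1) j(1) by (intro exI[of _ "i + 3 * L (f u) + j"]) auto
    qed
    ultimately show ?thesis
      unfolding c_sum by (intro exI[of _ "\<lambda>u. L (f u)"]) auto
  qed
  with tree FE show ?thesis by blast
qed

section \<open>From edge relations to digraphs\<close>

definition arc_restrict :: "('a, 'b) pre_digraph \<Rightarrow> 'a rel \<Rightarrow> ('a, 'b) pre_digraph" where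
  "arc_restrict G F = G\<lparr>arcs := {e \<in> arcs G. (tail G e, head G e) \<in> F}\<rparr>"

lemma arc_restrict_simps [simp]:
  "verts (arc_restrict G F) = verts G"
  "arcs (arc_restrict G F) = {e \<in> arcs G. (tail G e, head G e) \<in> F}"
  "tail (arc_restrict G F) = tail G"
  "head (arc_restrict G F) = head G"
  by (simp_all add: arc_restrict_def)

lemma arcs_ends_arc_restrict: "F \<subseteq> arcs_ends G \<Longrightarrow> arcs_ends (arc_restrict G F) = F"
  by (auto simp: arcs_ends_conv)

lemma (in wf_digraph) relpow_imp_awalk:
  assumes "(u, w) \<in> arcs_ends G ^^ k" "u \<in> verts G"
  shows "\<exists>p. awalk u p w \<and> length p = k"
  using assms
proof (induction k arbitrary: u)
  case 0
  then show ?case by (auto simp: awalk_Nil_iff)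
next
  case (Suc k)
  then obtain x where x: "(u, x) \<in> arcs_ends G" "(x, w) \<in> arcs_ends G ^^ k"
    by (meson relpow_Suc_D2)
  from x(1) obtain e where e: "e \<in> arcs G" "tail G e = u" "head G e = x"
    by (auto simp: arcs_ends_conv)
  from Suc.IH[OF x(2)] e obtain p where "awalk x p w" "length p = k" by auto
  with e show ?case by (intro exI[of _ "e # p"]) (auto simp: awalk_Cons_iff)
qed

lemma (in wf_digraph) graph_distance_le:
  assumes "(u, w) \<in> arcs_ends G ^^ k" "u \<in> verts G"
  shows "graph_distance G u w \<le> k"
  unfolding graph_distance_def using relpow_imp_awalk[OF assms] by (rule Least_le)

text \<open>Translates a cycle of arcs into the cyclic vertex list used in
  \<open>leaf_tree_acyclic\<close>: each arc leads from the head of the previous arc to its own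
  head.\<close>

lemma (in wf_digraph) cycle_vertices:
  assumes "cycle p"
  shows "distinct (map (head G) p)"
    and "\<And>i. i < length p \<Longrightarrow>
      (head G (p ! i), head G (p ! (Suc i mod length p))) \<in> arcs_ends G"
proof -
  from assms obtain u where u: "awalk u p u" "distinct (tl (awalk_verts u p))" "p \<noteq> []"
    by (auto simp: cycle_def)
  have cas: "cas u p u" and sub: "set p \<subseteq> arcs G" using u(1) by (auto simp: awalk_def)
  show "distinct (map (head G) p)"
    using u awalk_verts_conv'[OF cas] by simp
  \<comment> \<open>Two readings of the vertex list of the walk. Comparing entries shows that each
    arc starts at the head of the previous one; \<open>closed\<close> handles the
    wrap-around.\<close>
  have eq: "map (tail G) p @ [head G (last p)] = tail G (hd p) # map (head G) p"
    using awalk_verts_conv[of u p] awalk_verts_conv'[OF cas] u(3) by simp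
  have closed: "head G (last p) = tail G (hd p)"
    using u(1,3) awalk_verts_conv[of u p] awalk_verts_conv'[OF cas]
    by (metis awalk_conv last_snoc list.sel(1))
  fix i assume i: "i < length p"
  have "head G (p ! i) = tail G (p ! (Suc i mod length p))"
  proof (cases "Suc i < length p")
    case True
    then show ?thesis using arg_cong[OF eq, of "\<lambda>xs. xs ! Suc i"] by (simp add: nth_append)
  next
    case False
    then have "Suc i = length p" using i by simp
    then have "i = length p - 1" by simp
    then show ?thesis
      using closed u(3) by (simp add: last_conv_nth hd_conv_nth)
  qed
  moreover have "p ! (Suc i mod length p) \<in> arcs G"
    using sub u(3) by (auto intro!: subsetD[OF sub] nth_mem mod_less_divisor)
  ultimately show "(head G (p ! i), head G (p ! (Suc i mod length p))) \<in> arcs_ends G"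
    by (auto simp: arcs_ends_conv)
qed

lemma undirected_spanning_tree_arc_restrict:
  assumes G: "Digraph.graph G" and tree: "leaf_tree (verts G) F" and sub: "F \<subseteq> arcs_ends G"
  shows "undirected_spanning_tree (arc_restrict G F) G"
proof -
  interpret G: graph G by (rule G)
  let ?T = "arc_restrict G F"
  note ends = arcs_ends_arc_restrict[OF sub]
  interpret T: graph ?T
  proof
    show "symmetric ?T"
      unfolding symmetric_def ends using tree by (rule leaf_tree_sym)
  qed (auto simp: arc_to_ends_def dest: G.no_loops intro: G.no_multi_arcs)
  have "verts G \<noteq> {}" using tree by (induction) auto
  moreover have "u \<rightarrow>\<^sup>*\<^bsub>?T\<^esub> w" if "u \<in> verts G" "w \<in> verts G" for u w
    using leaf_tree_connected[OF tree that] that by (simp add: T.reachable_conv ends)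
  ultimately have "Digraph_Component.connected ?T"
    by (intro T.connectedI T.reachable_mk_symmetricI) simp_all
  moreover have "\<not> (T.cycle p \<and> 3 \<le> length p)" for p
  proof
    assume p: "T.cycle p \<and> 3 \<le> length p"
    with leaf_tree_acyclic[OF tree, of "map (head G) p"] T.cycle_vertices[of p]
    obtain i where i: "i < length p"
      "(head G (p ! i), map (head G) p ! (Suc i mod length p)) \<notin> F" by auto
    moreover have "Suc i mod length p < length p" using i(1) by (intro mod_less_divisor) auto
    ultimately show False using T.cycle_vertices(2)[of p i] p by (simp add: ends)
  qed
  moreover have "spanning ?T G"
    by (auto simp: spanning_def subgraph_def compatible_def G.wf_digraph T.wf_digraph)
  ultimately show ?thesis
    unfolding undirected_spanning_tree_def undirected_tree_def
    using T.graph_axioms by blast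
qed

lemma (in nomulti_digraph) out_degree_eq_card_Image: "out_degree G u = card (arcs_ends G `` {u})"
proof -
  have "arcs_ends G `` {u} = head G ` out_arcs G u"
    by (auto simp: arcs_ends_conv)
  moreover have "inj_on (head G) (out_arcs G u)"
    by (rule inj_onI) (auto simp: arc_to_ends_def intro: no_multi_arcs)
  ultimately show ?thesis by (simp add: out_degree_def card_image)
qed

section \<open>Averaging the distances in the tree\<close>

theorem theorem3p2:
  fixes G :: "('a, 'b) pre_digraph" and n \<delta> \<Delta> :: nat
  assumes "Digraph.graph G"
    and "Digraph_Component.connected G"
    and "card (verts G) = n" and "n \<ge> 2"
    and "min_degree G = \<delta>" and "max_degree G = \<Delta>"
  shows "\<exists>T. undirected_spanning_tree T G \<and>
    remoteness T \<le>
      3 * ((real n)\<^sup>2 - (real \<Delta>)\<^sup>2) / (2 * (real n - 1) * (real \<delta> + 1)) + 7"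
proof -
  interpret G: graph G by (rule assms)
  let ?V = "verts G" and ?E = "arcs_ends G"
  have ne: "?V \<noteq> {}" using assms(3,4) by auto
  have "\<Delta> \<in> out_degree G ` ?V"
    unfolding assms(6)[symmetric] max_degree_def using ne by (intro Max_in) auto
  then obtain v where v: "v \<in> ?V" "out_degree G v = \<Delta>" by auto
  have deg: "\<delta> \<le> card (?E `` {u})" if "u \<in> ?V" for u
    unfolding assms(5)[symmetric] min_degree_def G.out_degree_eq_card_Image[symmetric]
    using that by (intro Min_le) auto
  have conn: "(u, w) \<in> ?E\<^sup>*" if "u \<in> ?V" "w \<in> ?V" for u w
    using G.symmetric_connected_imp_strongly_connected[OF G.sym_arcs assms(2)] that
    by (auto intro: reachable_rtranclI)
  have EV: "?E \<subseteq> ?V \<times> ?V" by (auto dest: G.adj_in_verts)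
  have "sym ?E" using G.sym_arcs by (simp add: symmetric_def)
  moreover have "irrefl ?E" by (auto simp: irrefl_def dest: G.adj_not_same)
  moreover have "card (?E `` {v}) = \<Delta>"
    using v(2) by (simp add: G.out_degree_eq_card_Image)
  ultimately obtain F where F: "leaf_tree ?V F" "F \<subseteq> ?E"
    and dist: "\<And>w. w \<in> ?V \<Longrightarrow> \<exists>d. (\<forall>u\<in>?V. \<exists>k\<le>4 + 3 * d u. (w, u) \<in> F ^^ k) \<and>
      2 * (\<delta> + 1) * (\<Sum>u\<in>?V. d u) + \<Delta>\<^sup>2 \<le> n\<^sup>2"
    using spanning_leaf_tree[OF G.finite_verts EV _ _ v(1) conn deg] unfolding assms(3) by metis
  let ?T = "arc_restrict G F"
  have span: "undirected_spanning_tree ?T G"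
    by (rule undirected_spanning_tree_arc_restrict[OF assms(1) F])
  then interpret T: graph ?T
    by (simp add: undirected_spanning_tree_def undirected_tree_def)
  \<comment> \<open>The main term. The estimate below yields the additive constant 4, which is
    weakened to 7 at the end.\<close>
  define B where "B = 3 * ((real n)\<^sup>2 - (real \<Delta>)\<^sup>2) / (2 * (real n - 1) * (real \<delta> + 1))"
  have "average_distance ?T w \<le> B + 4" if w: "w \<in> ?V" for w
  proof -
    obtain d where d: "\<And>u. u \<in> ?V \<Longrightarrow> \<exists>k\<le>4 + 3 * d u. (w, u) \<in> F ^^ k"
      and sum_d: "2 * (\<delta> + 1) * (\<Sum>u\<in>?V. d u) + \<Delta>\<^sup>2 \<le> n\<^sup>2"
      using dist[OF w] by blast
    have dist_le: "graph_distance ?T w u \<le> 4 + 3 * d u" if "u \<in> ?V" for u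
      using d[OF that] T.graph_distance_le[of w u] w
      by (auto simp: arcs_ends_arc_restrict[OF F(2)] intro: order_trans)
    \<comment> \<open>As \<open>w\<close> has distance 0 from itself, the additive 4 is charged to
      only \<open>n - 1\<close> vertices, so it remains exactly 4 after division by
      \<open>n - 1\<close>.\<close>
    have "graph_distance ?T w w = 0"
      using T.graph_distance_le[of w w 0] w by simp
    then have "(\<Sum>u\<in>?V. graph_distance ?T w u) = (\<Sum>u\<in>?V - {w}. graph_distance ?T w u)"
      using w by (simp add: sum.remove[of ?V w])
    also have "\<dots> \<le> (\<Sum>u\<in>?V - {w}. 4 + 3 * d u)"
      using dist_le by (intro sum_mono) auto
    also have "\<dots> = 4 * (n - 1) + 3 * (\<Sum>u\<in>?V - {w}. d u)"
      using w assms(3) by (simp add: sum.distrib sum_distrib_left)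
    also have "\<dots> \<le> 4 * (n - 1) + 3 * (\<Sum>u\<in>?V. d u)"
      by (simp add: sum_mono2)
    finally have "real (\<Sum>u\<in>?V. graph_distance ?T w u) \<le> real (4 * (n - 1) + 3 * (\<Sum>u\<in>?V. d u))"
      by (rule of_nat_mono)
    then have le: "(\<Sum>u\<in>?V. real (graph_distance ?T w u))
        \<le> 4 * (real n - 1) + 3 * real (\<Sum>u\<in>?V. d u)"
      using assms(4) by (simp add: of_nat_diff)
    have "real (2 * (\<delta> + 1) * (\<Sum>u\<in>?V. d u) + \<Delta>\<^sup>2) \<le> real (n\<^sup>2)"
      using sum_d by (rule of_nat_mono)
    then have "2 * (real \<delta> + 1) * real (\<Sum>u\<in>?V. d u) \<le> (real n)\<^sup>2 - (real \<Delta>)\<^sup>2"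
      by (simp add: algebra_simps)
    then have "3 * real (\<Sum>u\<in>?V. d u)
        \<le> 3 * ((real n)\<^sup>2 - (real \<Delta>)\<^sup>2) / (2 * (real \<delta> + 1))"
      by (simp add: pos_le_divide_eq algebra_simps)
    also have "\<dots> = B * (real n - 1)"
    proof -
      have "real n - 1 \<noteq> 0" "real \<delta> + 1 \<noteq> 0" using assms(4) by auto
      then show ?thesis 
        unfolding B_def
        by (simp only: mult.assoc mult.commute mult.left_commute times_divide_eq_left
            times_divide_eq_right) (simp add: mult.left_commute)
    qed
    finally have "(\<Sum>u\<in>?V. real (graph_distance ?T w u)) \<le> (B + 4) * (real n - 1)"
      using le by (simp add: algebra_simps)
    then show ?thesis
      using assms(3,4) by (simp add: average_distance_def pos_divide_le_eq)
  qed
  then have "remoteness ?T \<le> B + 4"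
    unfolding remoteness_def using ne by simp
  then show ?thesis
    using span unfolding B_def by (intro exI[of _ ?T]) simp
qed

end
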